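(* Let $a<b$ be real numbers and $q\in(0,1)$. Let $f:[a,b]\to\mathbb{R}$ be $q$-integrable over $[a,b]$, and further assume that $f$ is continuous at $a$. Then for all $x\in[a,b]$ the following inequality holds: $$\left|f(x)-\frac{1}{b-a}\int_a^b f(t)\,d_q^a t\right| \le M(x)\,\left\|D_q^a f\right\|_\infty^{(a,b]},$$ where $$M(x)=\begin{cases}(b-a)\left(\dfrac{1+2q\left(\frac{x-a}{b-a}\right)^2}{1+q}-\dfrac{x-a}{b-a}\right), & \text{if } x=a+q^m(b-a)\text{ for some integer } m\ge 0,\\[2ex](b-a)\left(\dfrac{x-a}{b-a}+\dfrac{1}{1+q}\right), & \text{otherwise,}\end{cases}$$ is a discontinuous function of $x$. This inequality is sharp: for every $x\in[a,b]$ there exists a function $f:[a,b]\to\mathbb{R}$, $q$-integrable over $[a,b]$ and continuous at $a$, with $0<\|D_q^a f\|_\infty^{(a,b]}<\infty$, for which equality holds at $x$.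
   Context: Let $f:[a,b]\to\mathbb{R}$ and $q\in(0,1)$. The (shifted) $q$-derivative of $f$ at $x\in(a,b]$ is $$D_q^a f(x)=\frac{f(x)-f(a+q(x-a))}{(1-q)(x-a)}.$$ The (shifted) $q$-integral is $$\int_a^b f(t)\,d_q^a t=(1-q)(b-a)\sum_{k=0}^\infty q^k f\big(a+q^k(b-a)\big),$$ and $f$ is called $q$-integrable over $[a,b]$ if this series converges. For a function $g$ defined on $(a,b]$, $\|g\|_\infty^{(a,b]}=\sup_{t\in(a,b]}|g(t)|\in[0,+\infty]$; if this is $+\infty$ the inequality is understood to hold trivially. *)

theory Defs
  imports Complex_Main "HOL-Library.Extended_Real"
begin

text \<open>
  A function \<open>[a,b] \<rightarrow> \<real>\<close> is represented by a total function on the reals. For \<open>0 < q < 1\<close> and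
  \<open>a < b\<close> the q-integral and the supremum over \<open>{a<..b}\<close> of the q-derivative
  depend only on the values of the function on \<open>{a..b}\<close>.
\<close>

text \<open>Only meaningful for \<open>x \<noteq> a\<close>.\<close>

definition q_deriv :: "real \<Rightarrow> real \<Rightarrow> (real \<Rightarrow> real) \<Rightarrow> real \<Rightarrow> real" where
  "q_deriv q a f x = (f x - f (a + q * (x - a))) / ((1 - q) * (x - a))"

definition q_integrable :: "real \<Rightarrow> real \<Rightarrow> real \<Rightarrow> (real \<Rightarrow> real) \<Rightarrow> bool" where
  "q_integrable q a b f \<longleftrightarrow> summable (\<lambda>k. q ^ k * f (a + q ^ k * (b - a)))"

definition q_integral :: "real \<Rightarrow> real \<Rightarrow> real \<Rightarrow> (real \<Rightarrow> real) \<Rightarrow> real" where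
  "q_integral q a b f = (1 - q) * (b - a) * (\<Sum>k. q ^ k * f (a + q ^ k * (b - a)))"

text \<open>The value is \<open>\<infinity>\<close> exactly when \<open>g\<close> is unbounded on \<open>A\<close>; used for nonempty \<open>A\<close> only
  (the supremum over the empty set would be \<open>-\<infinity>\<close>).\<close>

definition sup_norm_on :: "real set \<Rightarrow> (real \<Rightarrow> real) \<Rightarrow> ereal" where
  "sup_norm_on A g = (SUP t\<in>A. ereal \<bar>g t\<bar>)"

definition ostrowski_M :: "real \<Rightarrow> real \<Rightarrow> real \<Rightarrow> real \<Rightarrow> real" where
  "ostrowski_M q a b x =
     (if \<exists>m::nat. x = a + q ^ m * (b - a)
      then (b - a) * ((1 + 2 * q * ((x - a) / (b - a))\<^sup>2) / (1 + q) - (x - a) / (b - a))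
      else (b - a) * ((x - a) / (b - a) + 1 / (1 + q)))"

end

theory Submission
  imports Defs
begin

text \<open>
  Put \<open>x\<^sub>k = a + q\<^sup>k (b - a)\<close>. Then
  \<open>f x - 1/(b - a) \<integral> f = (1 - q) \<Sum> q\<^sup>k (f x - f x\<^sub>k)\<close>, and a bound \<open>N\<close> on the q-derivative says that
  \<open>f\<close> is \<open>N\<close>-Lipschitz along each orbit of \<open>t \<mapsto> a + q (t - a)\<close>, including its limit \<open>a\<close> by continuity. If
  \<open>x = x\<^sub>m\<close>, each summand is at most \<open>N |x\<^sub>m - x\<^sub>k|\<close>, with equality for \<open>f t = |t - x|\<close>. Otherwise
  \<open>x\<close> and the \<open>x\<^sub>k\<close> lie on different orbits, which communicate only through \<open>a\<close>, so each summand is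
  at most \<open>N ((x - a) + (x\<^sub>k - a))\<close>, with equality for the function that equals \<open>t - a\<close> on the
  orbit of \<open>b\<close> and \<open>-(t - a)\<close> elsewhere.
\<close>

section \<open>Closed forms of the series behind the constant\<close>

lemma sums_q_squares:
  fixes q :: real
  assumes "0 < q" "q < 1"
  shows "(\<lambda>k. q ^ k * q ^ k) sums (1 / ((1 - q) * (1 + q)))"
proof -
  have "q\<^sup>2 < 1"
    using assms by (simp add: abs_square_less_1)
  then have "(\<lambda>k. (q\<^sup>2) ^ k) sums (1 / (1 - q\<^sup>2))"
    using assms by (intro geometric_sums) auto
  moreover have "(q\<^sup>2) ^ k = q ^ k * q ^ k" for k
    by (simp add: power2_eq_square power_mult_distrib)
  moreover have "1 - q\<^sup>2 = (1 - q) * (1 + q)"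
    by (simp add: power2_eq_square algebra_simps)
  ultimately show ?thesis by simp
qed

lemma sums_q_add:
  fixes q u :: real
  assumes "0 < q" "q < 1"
  shows "(\<lambda>k. q ^ k * (u + q ^ k)) sums ((u + 1 / (1 + q)) / (1 - q))"
proof -
  have "(\<lambda>k. q ^ k) sums (1 / (1 - q))"
    using assms by (intro geometric_sums) auto
  from sums_add[OF sums_mult[OF this, of u] sums_q_squares[OF assms]]
  have "(\<lambda>k. q ^ k * (u + q ^ k)) sums (u * (1 / (1 - q)) + 1 / ((1 - q) * (1 + q)))"
    by (simp add: algebra_simps)
  also have "u * (1 / (1 - q)) + 1 / ((1 - q) * (1 + q)) = (u + 1 / (1 + q)) / (1 - q)"
    using assms by (simp add: add_divide_distrib mult.commute)
  finally show ?thesis .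
qed

text \<open>For \<open>k \<ge> m\<close> the absolute value opens to \<open>q ^ m - q ^ k\<close>.
  Using this expression for all \<open>k\<close> gives two geometric series; the finitely many
  indices \<open>k < m\<close> have the opposite sign, which the correction
  \<open>2 * (q ^ k * (q ^ k - q ^ m))\<close> repairs.\<close>

lemma sums_q_abs_diff:
  fixes q :: real
  assumes "0 < q" "q < 1"
  shows "(\<lambda>k. q ^ k * \<bar>q ^ m - q ^ k\<bar>) sums (((1 + 2 * q * (q ^ m)\<^sup>2) / (1 + q) - q ^ m) / (1 - q))"
proof -
  \<comment> \<open>The parameter \<open>u\<close> stands for \<open>q ^ m\<close>; it is kept
    separate from the number of terms so that the induction on \<open>m\<close> leaves it
    fixed.\<close>
  have fin: "(\<Sum>k<m. 2 * (q ^ k * (q ^ k - u)))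
      = 2 * (1 - (q ^ m)\<^sup>2) / ((1 - q) * (1 + q)) - 2 * u * (1 - q ^ m) / (1 - q)" for u
  proof (induction m)
    case (Suc m)
    have nz: "1 - q \<noteq> 0" "1 + q \<noteq> 0" using assms by auto
    show ?case
      unfolding sum.lessThan_Suc Suc.IH using nz
      by (simp add: divide_simps power2_eq_square) (simp add: algebra_simps)
  qed simp
  have le: "q ^ k \<le> q ^ m" if "m \<le> k" for k
    using assms that by (intro power_decreasing) auto
  have ge: "q ^ m \<le> q ^ k" if "k \<le> m" for k
    using assms that by (intro power_decreasing) auto
  have g: "(\<lambda>k. q ^ m * q ^ k) sums (q ^ m * (1 / (1 - q)))"
    using assms by (intro sums_mult geometric_sums) auto
  have "(\<lambda>k. (q ^ m * q ^ k - q ^ k * q ^ k) + (if k \<in> {..<m} then 2 * (q ^ k * (q ^ k - q ^ m)) else 0))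
     sums ((q ^ m * (1 / (1 - q)) - 1 / ((1 - q) * (1 + q))) + (\<Sum>k<m. 2 * (q ^ k * (q ^ k - q ^ m))))"
    by (intro sums_add sums_diff g sums_q_squares assms sums_If_finite_set) auto
  moreover have "(q ^ m * q ^ k - q ^ k * q ^ k) + (if k \<in> {..<m} then 2 * (q ^ k * (q ^ k - q ^ m)) else 0)
     = q ^ k * \<bar>q ^ m - q ^ k\<bar>" for k
    using le[of k] ge[of k] by (cases "k < m") (auto simp: abs_if algebra_simps)
  moreover have "(q ^ m * (1 / (1 - q)) - 1 / ((1 - q) * (1 + q))) + (\<Sum>k<m. 2 * (q ^ k * (q ^ k - q ^ m)))
     = ((1 + 2 * q * (q ^ m)\<^sup>2) / (1 + q) - q ^ m) / (1 - q)"
  proof -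
    have nz: "1 - q \<noteq> 0" "1 + q \<noteq> 0" using assms by auto
    show ?thesis
      unfolding fin using nz by (simp add: divide_simps power2_eq_square) (simp add: algebra_simps)
  qed
  ultimately show ?thesis by simp
qed

section \<open>The constant as a weighted series of distances\<close>

text \<open>This explains the first branch of \<open>ostrowski_M\<close>: it is the mean distance
  from one orbit point to all of them, with weights \<open>(1 - q) * q ^ k\<close>.\<close>

lemma ostrowski_M_on_orbit:
  assumes "a < b" "0 < q" "q < 1"
  shows "(\<lambda>k. q ^ k * ((b - a) * \<bar>q ^ m - q ^ k\<bar>)) sums (ostrowski_M q a b (a + q ^ m * (b - a)) / (1 - q))"
  using sums_mult[OF sums_q_abs_diff[OF assms(2,3), of m], of "b - a"] assms(1)
  by (auto simp: ostrowski_M_def mult_ac)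

text \<open>The length of the path through \<open>a\<close> replaces the distance. The point
  \<open>x = a\<close> belongs here, since all orbit points lie strictly to its right.\<close>

lemma ostrowski_M_off_orbit:
  assumes "a < b" "0 < q" "q < 1" "\<nexists>m::nat. x = a + q ^ m * (b - a)"
  shows "(\<lambda>k. q ^ k * ((x - a) + q ^ k * (b - a))) sums (ostrowski_M q a b x / (1 - q))"
proof -
  have "q ^ k * ((x - a) + q ^ k * (b - a)) = (b - a) * (q ^ k * ((x - a) / (b - a) + q ^ k))" for k
    using assms(1) by (simp add: field_simps)
  moreover have "ostrowski_M q a b x = (b - a) * ((x - a) / (b - a) + 1 / (1 + q))"
    using assms(4) by (simp only: ostrowski_M_def if_False)
  ultimately show ?thesis
    using sums_mult[OF sums_q_add[OF assms(2,3), of "(x - a) / (b - a)"], of "b - a"]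
    by (simp only: times_divide_eq_right)
qed

text \<open>On the orbit the closed form hides its sign, so positivity is read off the series.
  Strictness avoids the product of 0 and \<infinity>, which is 0 in \<open>ereal\<close>, when the
  q-derivative is unbounded; the sign also resolves the absolute value in the extremal
  cases.\<close>

lemma ostrowski_M_pos:
  assumes "a < b" "0 < q" "q < 1" "a \<le> x"
  shows "0 < ostrowski_M q a b x"
proof (cases "\<exists>m::nat. x = a + q ^ m * (b - a)")
  case True
  then obtain m :: nat where x: "x = a + q ^ m * (b - a)" by blast
  let ?s = "\<lambda>k. q ^ k * ((b - a) * \<bar>q ^ m - q ^ k\<bar>)"
  have s: "?s sums (ostrowski_M q a b x / (1 - q))"
    using ostrowski_M_on_orbit[OF assms(1-3)] x by simp
  have "q ^ Suc m < q ^ m"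
    using assms by (intro power_strict_decreasing) auto
  then have "0 < ?s (Suc m)"
    using assms by (intro mult_pos_pos zero_less_power) auto
  then have "0 < (\<Sum>k. ?s k)"
    using assms by (intro suminf_pos2[where i = "Suc m"] sums_summable[OF s]) auto
  then show ?thesis
    using assms by (simp add: sums_unique[OF s, symmetric] zero_less_divide_iff)
next
  case False
  then have "ostrowski_M q a b x = (b - a) * ((x - a) / (b - a) + 1 / (1 + q))"
    by (simp only: ostrowski_M_def if_False)
  then show ?thesis
    using assms by (auto intro!: mult_pos_pos add_nonneg_pos divide_nonneg_pos)
qed

section \<open>Deviation from the mean and Lipschitz estimates along orbits\<close>

lemma orbit_in_interval:
  fixes a b q :: real
  assumes "a < b" "0 < q" "q < 1"
  shows "a + q ^ k * (b - a) \<in> {a<..b}"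
proof -
  have "q ^ k * (b - a) \<le> 1 * (b - a)"
    using assms by (intro mult_right_mono power_le_one) auto
  then have "a + q ^ k * (b - a) \<le> b" by (simp only: mult_1 le_diff_eq add.commute)
  then show ?thesis using assms by auto
qed

text \<open>The weights \<open>(1 - q) * q ^ k\<close> sum to 1, so the deviation from the mean is
  the weighted mean of the differences.\<close>

lemma sums_q_deviation:
  assumes "a < b" "0 < q" "q < 1" "q_integrable q a b f"
  shows "(\<lambda>k. q ^ k * (f x - f (a + q ^ k * (b - a)))) sums
           ((f x - 1 / (b - a) * q_integral q a b f) / (1 - q))"
proof -
  have g: "(\<lambda>k. q ^ k * f x) sums (1 / (1 - q) * f x)"
    using assms by (intro sums_mult2 geometric_sums) auto
  have "(\<lambda>k. q ^ k * f x - q ^ k * f (a + q ^ k * (b - a))) sums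
     (1 / (1 - q) * f x - (\<Sum>k. q ^ k * f (a + q ^ k * (b - a))))"
    using assms(4) unfolding q_integrable_def by (intro sums_diff[OF g] summable_sums)
  moreover have "1 / (1 - q) * f x - s = (f x - 1 / (b - a) * ((1 - q) * (b - a) * s)) / (1 - q)" for s
    using assms by (simp add: diff_divide_distrib)
  ultimately show ?thesis
    unfolding q_integral_def by (simp only: right_diff_distrib[of "q ^ _"])
qed

text \<open>Clearing the denominator of the q-derivative bounds the change of \<open>f\<close> in
  each step of the orbit by \<open>N\<close> times the step length. All steps go left, so the
  lengths telescope.\<close>

lemma q_deriv_orbit_lipschitz:
  assumes "a < b" "0 < q" "q < 1" "y \<in> {a<..b}"
    and N: "\<And>t. t \<in> {a<..b} \<Longrightarrow> \<bar>q_deriv q a f t\<bar> \<le> N"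
  shows "\<bar>f y - f (a + q ^ n * (y - a))\<bar> \<le> N * ((y - a) * (1 - q ^ n))"
proof (induction n)
  case (Suc n)
  let ?t = "a + q ^ n * (y - a)"
  have t: "?t \<in> {a<..b}"
    using orbit_in_interval[of a y q n] assms by auto
  have "\<bar>f ?t - f (a + q * (?t - a))\<bar> = \<bar>q_deriv q a f ?t\<bar> * ((1 - q) * (?t - a))"
    using t assms by (simp add: q_deriv_def abs_mult)
  also have "\<dots> \<le> N * ((1 - q) * (?t - a))"
    using N[OF t] t assms by (intro mult_right_mono) auto
  finally have "\<bar>f ?t - f (a + q ^ Suc n * (y - a))\<bar> \<le> N * ((1 - q) * (q ^ n * (y - a)))"
    by (simp add: mult.assoc)
  then have "\<bar>f y - f (a + q ^ Suc n * (y - a))\<bar>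
      \<le> N * ((y - a) * (1 - q ^ n)) + N * ((1 - q) * (q ^ n * (y - a)))"
    using Suc.IH by linarith
  then show ?case by (simp add: algebra_simps)
qed simp

text \<open>The orbit of \<open>y\<close> converges to \<open>a\<close>; continuity at
  \<open>a\<close> lets the orbit estimate pass to the limit.\<close>

lemma q_deriv_lipschitz_at_left_end:
  assumes "a < b" "0 < q" "q < 1" "y \<in> {a..b}"
    and cont: "continuous (at a within {a..b}) f"
    and N: "\<And>t. t \<in> {a<..b} \<Longrightarrow> \<bar>q_deriv q a f t\<bar> \<le> N"
  shows "\<bar>f y - f a\<bar> \<le> N * (y - a)"
proof (cases "y = a")
  case False
  then have y: "y \<in> {a<..b}" using assms by auto
  have q0: "(\<lambda>n. q ^ n) \<longlonglongrightarrow> 0"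
    using assms by (intro LIMSEQ_power_zero) auto
  have pt: "(\<lambda>n. a + q ^ n * (y - a)) \<longlonglongrightarrow> a"
    using tendsto_add[OF tendsto_const tendsto_mult_left_zero[OF q0, of "y - a"], of a] by simp
  \<comment> \<open>The punctured filter at \<open>a\<close> demands points different from
    \<open>a\<close>, which is why \<open>y = a\<close> was split off.\<close>
  have "a + q ^ n * (y - a) \<in> {a..b} \<and> a + q ^ n * (y - a) \<noteq> a" for n
    using orbit_in_interval[of a y q n] assms y by auto
  then have "filterlim (\<lambda>n. a + q ^ n * (y - a)) (at a within {a..b}) sequentially"
    unfolding filterlim_at using pt by simp
  then have "(\<lambda>n. f (a + q ^ n * (y - a))) \<longlonglongrightarrow> f a"
    using cont unfolding continuous_within by (rule filterlim_compose[rotated])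
  then have "(\<lambda>n. \<bar>f y - f (a + q ^ n * (y - a))\<bar>) \<longlonglongrightarrow> \<bar>f y - f a\<bar>"
    by (intro tendsto_intros)
  moreover have "(\<lambda>n. N * ((y - a) * (1 - q ^ n))) \<longlonglongrightarrow> N * ((y - a) * (1 - 0))"
    by (intro tendsto_intros q0)
  ultimately have "\<bar>f y - f a\<bar> \<le> N * ((y - a) * (1 - 0))"
    by (rule LIMSEQ_le) (use q_deriv_orbit_lipschitz[OF assms(1-3) y N] in blast)
  then show ?thesis by simp
qed simp

lemma abs_le_of_sums:
  fixes f g :: "nat \<Rightarrow> real"
  assumes "f sums s" "g sums t" "\<And>k. \<bar>f k\<bar> \<le> g k"
  shows "\<bar>s\<bar> \<le> t"
proof -
  have "s \<le> t"
    by (rule sums_le[OF _ assms(1,2)]) (use assms(3) in \<open>auto simp: abs_le_iff\<close>)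
  moreover have "- s \<le> t"
    by (rule sums_le[OF _ sums_minus[OF assms(1)] assms(2)]) (use assms(3) in \<open>auto simp: abs_le_iff\<close>)
  ultimately show ?thesis by simp
qed

section \<open>The inequality for a finite bound on the q-derivative\<close>

lemma q_ostrowski_bound:
  assumes "a < b" "0 < q" "q < 1" "x \<in> {a..b}" "q_integrable q a b f"
    and cont: "continuous (at a within {a..b}) f"
    and N: "\<And>t. t \<in> {a<..b} \<Longrightarrow> \<bar>q_deriv q a f t\<bar> \<le> N"
  shows "\<bar>f x - 1 / (b - a) * q_integral q a b f\<bar> \<le> ostrowski_M q a b x * N"
proof -
  let ?p = "\<lambda>k. a + q ^ k * (b - a)"
  \<comment> \<open>The majorant \<open>c k\<close> is the distance from \<open>x\<close> to
    \<open>?p k\<close>, measured along the orbit or through \<open>a\<close>; the summation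
    afterwards is common to both cases.\<close>
  obtain c where c: "(\<lambda>k. q ^ k * c k) sums (ostrowski_M q a b x / (1 - q))"
    and le: "\<And>k. \<bar>f x - f (?p k)\<bar> \<le> N * c k"
  proof (cases "\<exists>m::nat. x = ?p m")
    case True
    then obtain m :: nat where x: "x = ?p m" by blast
    \<comment> \<open>The orbit of \<open>?p i\<close> is a tail of the orbit of \<open>b\<close>,
      so \<open>?p j\<close> is reached from \<open>?p i\<close> in \<open>j - i\<close>
      steps.\<close>
    have lip: "\<bar>f (?p i) - f (?p j)\<bar> \<le> N * ((b - a) * (q ^ i - q ^ j))" if "i \<le> j" for i j
    proof -
      define d where "d = j - i"
      have "q ^ j = q ^ i * q ^ d" using that by (simp add: d_def flip: power_add)
      then have "a + q ^ d * (?p i - a) = ?p j" "(?p i - a) * (1 - q ^ d) = (b - a) * (q ^ i - q ^ j)"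
        by (auto simp: algebra_simps)
      then show ?thesis
        using q_deriv_orbit_lipschitz[OF assms(1-3) orbit_in_interval[OF assms(1-3), of i] N, of d]
        by (simp only:)
    qed
    have "\<bar>f x - f (?p k)\<bar> \<le> N * ((b - a) * \<bar>q ^ m - q ^ k\<bar>)" for k
    proof (cases "m \<le> k")
      case True
      then have "q ^ k \<le> q ^ m" using assms by (intro power_decreasing) auto
      then show ?thesis using lip[OF True] x by simp
    next
      case False
      then have "q ^ m \<le> q ^ k" using assms by (intro power_decreasing) auto
      then show ?thesis using lip[of k m] False x by (simp add: abs_minus_commute)
    qed
    then show thesis using that[of "\<lambda>k. (b - a) * \<bar>q ^ m - q ^ k\<bar>"]
      ostrowski_M_on_orbit[OF assms(1-3), of m] x by simp
  next
    case False
    have "\<bar>f x - f (?p k)\<bar> \<le> N * ((x - a) + q ^ k * (b - a))" for k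
    proof -
      have "?p k \<in> {a..b}" using orbit_in_interval[OF assms(1-3), of k] by auto
      from q_deriv_lipschitz_at_left_end[OF assms(1-3) this cont N]
        q_deriv_lipschitz_at_left_end[OF assms(1-4) cont N]
      have "\<bar>f x - f (?p k)\<bar> \<le> N * (x - a) + N * (q ^ k * (b - a))"
        by simp
      then show ?thesis by (simp add: distrib_left)
    qed
    then show thesis using that[OF ostrowski_M_off_orbit[OF assms(1-3) False]] by blast
  qed
  have "\<bar>q ^ k * (f x - f (?p k))\<bar> \<le> N * (q ^ k * c k)" for k
    using mult_left_mono[OF le[of k], of "q ^ k"] assms by (simp add: abs_mult mult_ac)
  from abs_le_of_sums[OF sums_q_deviation[OF assms(1-3,5), of x] sums_mult[OF c, of N] this]
  show ?thesis using assms by (simp add: divide_simps mult_ac)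
qed

section \<open>Extremal functions\<close>

text \<open>This makes the extremal functions admissible. The case \<open>t = a\<close> forces
  \<open>c = f a\<close>; the bound squeezes \<open>f\<close> towards \<open>c\<close> at
  \<open>a\<close> and bounds it on the orbit, so a geometric series dominates.\<close>

lemma q_integrable_lipschitz_at_left_end:
  assumes "a < b" "0 < q" "q < 1" and le: "\<And>t. \<bar>f t - c\<bar> \<le> \<bar>t - a\<bar>"
  shows "q_integrable q a b f" "continuous (at a within S) f"
proof -
  have c: "f a = c" using le[of a] by simp
  have dom: "\<bar>q ^ k * f (a + q ^ k * (b - a))\<bar> \<le> q ^ k * (\<bar>c\<bar> + (b - a))" for k
  proof -
    have "\<bar>f (a + q ^ k * (b - a))\<bar> \<le> \<bar>c\<bar> + (b - a)"
      using le[of "a + q ^ k * (b - a)"] orbit_in_interval[OF assms(1-3), of k] by auto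
    then show ?thesis using assms by (simp add: abs_mult mult_left_mono)
  qed
  have "summable (\<lambda>k. q ^ k * (\<bar>c\<bar> + (b - a)))"
    using assms by (intro summable_mult2 summable_geometric) auto
  then show "q_integrable q a b f"
    unfolding q_integrable_def by (rule summable_comparison_test') (use dom in simp)
  have "((\<lambda>t. f t - c) \<longlongrightarrow> 0) (at a within S)"
  proof (rule tendsto_0_le)
    show "\<forall>\<^sub>F t in at a within S. norm (f t - c) \<le> norm \<bar>t - a\<bar> * 1"
      using le by (intro always_eventually) simp
    have "((\<lambda>t. \<bar>t - a\<bar>) \<longlongrightarrow> \<bar>a - a\<bar>) (at a within S)"
      by (intro tendsto_intros)
    then show "((\<lambda>t. \<bar>t - a\<bar>) \<longlongrightarrow> 0) (at a within S)" by simp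
  qed
  then show "continuous (at a within S) f"
    unfolding continuous_within c by (rule LIM_zero_cancel)
qed

lemma sup_norm_on_eq_one:
  assumes "\<And>t. t \<in> A \<Longrightarrow> \<bar>g t\<bar> \<le> 1" "s \<in> A" "\<bar>g s\<bar> = 1"
  shows "sup_norm_on A g = 1"
  unfolding sup_norm_on_def
proof (rule antisym)
  show "(SUP t\<in>A. ereal \<bar>g t\<bar>) \<le> 1"
    using assms(1) by (intro SUP_least) (auto simp: one_ereal_def)
  show "1 \<le> (SUP t\<in>A. ereal \<bar>g t\<bar>)"
    using assms(2,3) by (intro SUP_upper2[of s]) (auto simp: one_ereal_def)
qed

text \<open>Both functions are normalised to norm 1 and make every difference
  \<open>f x - f (?p k)\<close> equal to minus its majorant, so nothing cancels in the
  series.\<close>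

lemma q_ostrowski_extremal:
  assumes "a < b" "0 < q" "q < 1" "x \<in> {a..b}"
  obtains f where "q_integrable q a b f" "continuous (at a within {a..b}) f"
    "sup_norm_on {a<..b} (q_deriv q a f) = 1"
    "\<bar>f x - 1 / (b - a) * q_integral q a b f\<bar> = ostrowski_M q a b x"
proof -
  let ?p = "\<lambda>k::nat. a + q ^ k * (b - a)"
  have M: "0 < ostrowski_M q a b x"
    using ostrowski_M_pos[OF assms(1-3)] assms(4) by simp
  show thesis
  proof (cases "\<exists>m. x = ?p m")
    case True
    then obtain m where x: "x = ?p m" by blast
    have xa: "x \<in> {a<..b}" using orbit_in_interval[OF assms(1-3)] x by simp
    let ?f = "\<lambda>t. \<bar>t - x\<bar>"
    have lip: "\<bar>?f t - \<bar>a - x\<bar>\<bar> \<le> \<bar>t - a\<bar>" for t by linarith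
    note f = q_integrable_lipschitz_at_left_end[of a b q ?f, OF assms(1-3) lip]
    have "sup_norm_on {a<..b} (q_deriv q a ?f) = 1"
    proof (rule sup_norm_on_eq_one[OF _ xa])
      fix t assume t: "t \<in> {a<..b}"
      have "\<bar>?f t - ?f (a + q * (t - a))\<bar> \<le> \<bar>t - (a + q * (t - a))\<bar>" by linarith
      also have "t - (a + q * (t - a)) = (1 - q) * (t - a)" by (simp add: algebra_simps)
      finally show "\<bar>q_deriv q a ?f t\<bar> \<le> 1"
        using t assms by (simp add: q_deriv_def abs_mult divide_simps)
    next
      \<comment> \<open>The supremum is attained at \<open>x\<close>, where \<open>?f\<close>
        vanishes, while its value at the next point of the orbit is the full step length.\<close>
      have "a + q * (x - a) - x = - ((1 - q) * (x - a))" by (simp add: algebra_simps)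
      then show "\<bar>q_deriv q a ?f x\<bar> = 1"
        using xa assms by (simp add: q_deriv_def abs_mult)
    qed
    moreover have "\<bar>?f x - 1 / (b - a) * q_integral q a b ?f\<bar> = ostrowski_M q a b x"
    proof -
      have "?f x - ?f (?p k) = - ((b - a) * \<bar>q ^ m - q ^ k\<bar>)" for k
      proof -
        have "?p k - x = - ((b - a) * (q ^ m - q ^ k))" by (simp add: x algebra_simps)
        then show ?thesis using assms by (simp add: abs_mult)
      qed
      then have "(\<lambda>k. - (q ^ k * ((b - a) * \<bar>q ^ m - q ^ k\<bar>)))
          sums ((?f x - 1 / (b - a) * q_integral q a b ?f) / (1 - q))"
        using sums_q_deviation[OF assms(1-3) f(1), of x] by simp
      from sums_unique2[OF this sums_minus[OF ostrowski_M_on_orbit[OF assms(1-3), of m]]]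
      have "?f x - 1 / (b - a) * q_integral q a b ?f = - ostrowski_M q a b x"
        using assms x by (simp add: divide_simps)
      then show ?thesis using M by simp
    qed
    ultimately show thesis using that f by blast
  next
    case False
    let ?f = "\<lambda>t. if \<exists>m. t = ?p m then t - a else - (t - a)"
    have lip: "\<bar>?f t - 0\<bar> \<le> \<bar>t - a\<bar>" for t by (simp add: abs_minus_commute)
    note f = q_integrable_lipschitz_at_left_end[of a b q ?f, OF assms(1-3) lip]
    have D: "\<bar>q_deriv q a ?f t\<bar> = 1" if t: "t \<in> {a<..b}" for t
    proof -
      \<comment> \<open>Membership in the orbit of \<open>b\<close> is preserved in both directions
        by one step, so both values in the difference quotient come from the same linear branch and
        the quotient is 1 or -1.\<close>
      have orbit: "(\<exists>m. a + q * (t - a) = ?p m) \<longleftrightarrow> (\<exists>m. t = ?p m)"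
      proof
        assume "\<exists>m. t = ?p m"
        then obtain m where "t = ?p m" by blast
        then have "a + q * (t - a) = ?p (Suc m)" by simp
        then show "\<exists>m. a + q * (t - a) = ?p m" by blast
      next
        assume "\<exists>m. a + q * (t - a) = ?p m"
        then obtain m where m: "a + q * (t - a) = ?p m" by blast
        show "\<exists>m. t = ?p m"
        proof (cases m)
          case 0
          \<comment> \<open>The index 0 would mean that the step lands on \<open>b\<close>, but it
            moves every point strictly left.\<close>
          have "q * (t - a) < 1 * (t - a)"
            using t assms by (intro mult_strict_right_mono) auto
          then show ?thesis using m 0 t by simp
        next
          case (Suc n)
          then have "t = ?p n" using m assms by simp
          then show ?thesis by blast
        qed
      qed
      have "(1 - q) * (t - a) \<noteq> 0" using t assms by simp
      then show ?thesis
        unfolding q_deriv_def orbit by (simp add: divide_simps) (auto simp: abs_if algebra_simps)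
    qed
    have "sup_norm_on {a<..b} (q_deriv q a ?f) = 1"
      by (rule sup_norm_on_eq_one[of _ _ b]) (use D assms(1) in auto)
    moreover have "\<bar>?f x - 1 / (b - a) * q_integral q a b ?f\<bar> = ostrowski_M q a b x"
    proof -
      have "?f x - ?f (?p k) = - ((x - a) + q ^ k * (b - a))" for k
      proof -
        have "?f x = - (x - a)" using False by (rule if_not_P)
        moreover have "?f (?p k) = ?p k - a" by (rule if_P) blast
        ultimately show ?thesis by linarith
      qed
      then have "(\<lambda>k. q ^ k * - ((x - a) + q ^ k * (b - a)))
          sums ((?f x - 1 / (b - a) * q_integral q a b ?f) / (1 - q))"
        using sums_q_deviation[OF assms(1-3) f(1), of x] by (simp only:)
      from sums_unique2[OF this[unfolded mult_minus_right] sums_minus[OF ostrowski_M_off_orbit[OF assms(1-3) False]]]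
      have "?f x - 1 / (b - a) * q_integral q a b ?f = - ostrowski_M q a b x"
        unfolding minus_divide_left divide_cancel_right using assms(3) by simp
      then show ?thesis using M by simp
    qed
    ultimately show thesis using that f by blast
  qed
qed

section \<open>Discontinuity of the constant\<close>

text \<open>The value at \<open>b\<close> differs from the left limit there: \<open>(a + q (b - a), b)\<close> misses the orbit of \<open>b\<close>.\<close>

lemma ostrowski_M_not_continuous:
  assumes "a < b" "0 < q" "q < 1"
  shows "\<not> continuous_on {a..b} (ostrowski_M q a b)"
proof
  assume c: "continuous_on {a..b} (ostrowski_M q a b)"
  \<comment> \<open>Relative positions in the gap between \<open>q\<close> and 1, tending to 1.
    Adding 2 in the denominator, not 1, keeps \<open>u 0\<close> off the value \<open>q\<close>,
    which is an orbit position.\<close>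
  define u where "u n = 1 - (1 - q) * (1 / (real n + 2))" for n
  have u: "q < u n" "u n < 1" for n
  proof -
    have "(1 - q) * (1 / (real n + 2)) < (1 - q) * 1"
      using assms by (intro mult_strict_left_mono) auto
    then show "q < u n" by (simp add: u_def)
    show "u n < 1" using assms by (simp add: u_def)
  qed
  have "(\<lambda>n. 1 / (real n + 2)) \<longlonglongrightarrow> 0"
    using LIMSEQ_ignore_initial_segment[OF lim_1_over_n, of 2] by (simp add: add.commute)
  then have "u \<longlonglongrightarrow> 1 - (1 - q) * 0"
    unfolding u_def by (intro tendsto_intros)
  then have lim: "u \<longlonglongrightarrow> 1" by simp
  define x where "x n = a + u n * (b - a)" for n
  have "x \<longlonglongrightarrow> a + 1 * (b - a)"
    unfolding x_def by (intro tendsto_intros lim)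
  then have xlim: "x \<longlonglongrightarrow> b" by simp
  have xin: "x n \<in> {a..b}" for n
  proof -
    have "u n * (b - a) \<le> 1 * (b - a)"
      using u(2)[of n] assms by (intro mult_right_mono) auto
    moreover have "0 \<le> u n * (b - a)" using u(1)[of n] assms by simp
    ultimately show ?thesis by (simp add: x_def)
  qed
  have Mx: "ostrowski_M q a b (x n) = (b - a) * (u n + 1 / (1 + q))" for n
  proof -
    have "\<nexists>m::nat. x n = a + q ^ m * (b - a)"
    proof
      assume "\<exists>m::nat. x n = a + q ^ m * (b - a)"
      then obtain m where "u n = q ^ m" using assms by (auto simp: x_def)
      moreover have "q ^ m \<le> q" if "m \<noteq> 0"
        using power_decreasing[of 1 m q] that assms by simp
      ultimately show False using u[of n] by (cases "m = 0") auto
    qed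
    then have "ostrowski_M q a b (x n) = (b - a) * ((x n - a) / (b - a) + 1 / (1 + q))"
      by (simp only: ostrowski_M_def if_False)
    then show ?thesis using assms by (simp add: x_def)
  qed
  have "(\<lambda>n. ostrowski_M q a b (x n)) \<longlonglongrightarrow> ostrowski_M q a b b"
    by (rule continuous_on_tendsto_compose[OF c xlim]) (use xin assms in auto)
  moreover have "(\<lambda>n. ostrowski_M q a b (x n)) \<longlonglongrightarrow> (b - a) * (1 + 1 / (1 + q))"
    unfolding Mx by (intro tendsto_intros lim)
  ultimately have "ostrowski_M q a b b = (b - a) * (1 + 1 / (1 + q))"
    by (rule LIMSEQ_unique)
  moreover have "ostrowski_M q a b b = (b - a) * ((1 + 2 * q) / (1 + q) - 1)"
  proof -
    have "b = a + q ^ 0 * (b - a)" by simp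
    then have "\<exists>m::nat. b = a + q ^ m * (b - a)" by blast
    then show ?thesis using assms by (simp add: ostrowski_M_def)
  qed
  \<comment> \<open>After multiplication by \<open>1 + q\<close> this reads
    \<open>q = 2 + q\<close>.\<close>
  ultimately have "(1 + 2 * q) / (1 + q) - 1 = 1 + 1 / (1 + q)"
    using assms by simp
  then show False using assms by (simp add: field_simps)
qed

section \<open>The full statement, with a possibly infinite norm\<close>

theorem corollary16:
  fixes a b q :: real
  assumes "a < b" and "0 < q" and "q < 1"
  shows
    "(\<forall>f :: real \<Rightarrow> real.
        q_integrable q a b f \<and> continuous (at a within {a..b}) f \<longrightarrow>
        (\<forall>x\<in>{a..b}.
           ereal \<bar>f x - 1 / (b - a) * q_integral q a b f\<bar>
             \<le> ereal (ostrowski_M q a b x) * sup_norm_on {a<..b} (q_deriv q a f)))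
     \<and> \<not> continuous_on {a..b} (ostrowski_M q a b)
     \<and> (\<forall>x\<in>{a..b}. \<exists>f :: real \<Rightarrow> real.
           q_integrable q a b f \<and> continuous (at a within {a..b}) f \<and>
           0 < sup_norm_on {a<..b} (q_deriv q a f) \<and>
           sup_norm_on {a<..b} (q_deriv q a f) < \<infinity> \<and>
           ereal \<bar>f x - 1 / (b - a) * q_integral q a b f\<bar>
             = ereal (ostrowski_M q a b x) * sup_norm_on {a<..b} (q_deriv q a f))"
proof (intro conjI allI impI ballI)
  fix f :: "real \<Rightarrow> real" and x
  assume f: "q_integrable q a b f \<and> continuous (at a within {a..b}) f" and x: "x \<in> {a..b}"
  let ?S = "sup_norm_on {a<..b} (q_deriv q a f)"
  have up: "ereal \<bar>q_deriv q a f t\<bar> \<le> ?S" if "t \<in> {a<..b}" for t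
    unfolding sup_norm_on_def using that by (rule SUP_upper)
  have M: "0 < ostrowski_M q a b x"
    using ostrowski_M_pos[OF assms] x by simp
  show "ereal \<bar>f x - 1 / (b - a) * q_integral q a b f\<bar> \<le> ereal (ostrowski_M q a b x) * ?S"
  \<comment> \<open>An infinite norm makes the right-hand side infinite, as the constant is
    positive. The value -\<infinity> is excluded by the nonnegative entry at
    \<open>b\<close>.\<close>
  proof (cases ?S)
    case (real N)
    then have "\<bar>q_deriv q a f t\<bar> \<le> N" if "t \<in> {a<..b}" for t
      using up[OF that] by simp
    then show ?thesis
      using q_ostrowski_bound[OF assms x] f real by simp
  next
    case PInf
    then show ?thesis using M by simp
  next
    case MInf
    then show ?thesis using up[of b] assms by simp
  qed
next
  show "\<not> continuous_on {a..b} (ostrowski_M q a b)"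
    by (rule ostrowski_M_not_continuous[OF assms])
next
  fix x assume "x \<in> {a..b}"
  then obtain f where f: "q_integrable q a b f" "continuous (at a within {a..b}) f"
    "sup_norm_on {a<..b} (q_deriv q a f) = 1"
    "\<bar>f x - 1 / (b - a) * q_integral q a b f\<bar> = ostrowski_M q a b x"
    using q_ostrowski_extremal[OF assms] by blast
  show "\<exists>f :: real \<Rightarrow> real.
           q_integrable q a b f \<and> continuous (at a within {a..b}) f \<and>
           0 < sup_norm_on {a<..b} (q_deriv q a f) \<and>
           sup_norm_on {a<..b} (q_deriv q a f) < \<infinity> \<and>
           ereal \<bar>f x - 1 / (b - a) * q_integral q a b f\<bar>
             = ereal (ostrowski_M q a b x) * sup_norm_on {a<..b} (q_deriv q a f)"
    by (intro exI[of _ f] conjI) (use f in auto)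
qed

end
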